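(* Let $L$ be a PG-lattice and let $M$ be a faithful multiplication PG-lattice $L$-module with $I_M$ compact. If a proper element $N\in M$ is pseudo-classical primary, then $rad(N)$ is a prime element of $M$.
   Context: A multiplicative lattice $L$ is a complete lattice (least element $0$, greatest element $1$) with a commutative, associative multiplication that distributes over arbitrary joins and has $1$ as identity. An element $a$ of a complete lattice is compact if $a\leqslant \bigvee X$ implies $a\leqslant x_1\vee\cdots\vee x_n$ for finitely many $x_i\in X$. Standing assumption: every element of $L$ is a join of compact elements of $L$, $1$ is compact, and finite products of compact elements of $L$ are compact. For $a,b\in L$, $(a:b)=\bigvee\{x\in L\mid xb\leqslant a\}$. An element $e\in L$ is principal if $a\wedge be=((a:e)\wedge b)e$ and $(ae\vee b):e=(b:e)\vee a$ for all $a,b\in L$. $L$ is a PG-lattice if each element of $L$ is a join of principal elements of $L$. An $L$-module $M$ is a complete lattice (least element $O_M$, greatest element $I_M$) with a multiplication $L\times M\to M$, $(a,A)\mapsto aA$, such that $(\bigvee_\alpha a_\alpha)A=\bigvee_\alpha a_\alpha A$, $a(\bigvee_\alpha A_\alpha)=\bigvee_\alpha aA_\alpha$, $(ab)A=a(bA)$, $1A=A$, $0A=O_M$. For $A,B\in M$, $(A:B)=\bigvee\{x\in L\mid xB\leqslant A\}\in L$. $M$ is faithful if $(O_M:I_M)=0$; $M$ is a multiplication lattice module if every $N\in M$ has the form $N=aI_M$ with $a\in L$. An element $N\in M$ is principal if $(b\wedge(B:N))N=bN\wedge B$ and $b\vee(B:N)=((bN\vee B):N)$ for all $b\in L$, $B\in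 M$; $M$ is a PG-lattice $L$-module if each element of $M$ is a join of principal elements of $M$. $N\in M$ is proper if $N<I_M$. A proper $N\in M$ is prime if for all $a\in L$, $X\in M$, $aX\leqslant N$ implies $X\leqslant N$ or $aI_M\leqslant N$. For a proper $N$, $rad(N)=\bigwedge\{P\in M\mid P\text{ is prime and }N\leqslant P\}$ (the empty meet is $I_M$). A proper $N\in M$ is pseudo-classical primary if for all $a,b\in L$, $K\in M$, $abK\leqslant N$ implies $aK\leqslant N$ or $bK\leqslant rad(N)$. *)

theory Defs
  imports Main
begin

unbundle lattice_syntax

text \<open>For \<open>F = {}\<close> the join \<open>\<Squnion>F\<close> is the least element, so the least element is compact.\<close>

definition (in complete_lattice) compact_element :: "'a \<Rightarrow> bool" where
  "compact_element a \<longleftrightarrow> (\<forall>X. a \<le> \<Squnion>X \<longrightarrow> (\<exists>F. finite F \<and> F \<subseteq> X \<and> a \<le> \<Squnion>F))"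

text \<open>The elements \<open>0\<close> and \<open>1\<close> of a multiplicative lattice are its least and greatest
  elements; below, \<open>0\<close> is written \<open>\<bottom>\<close>.\<close>

class multiplicative_lattice = complete_lattice + comm_monoid_mult +
  assumes one_eq_top: "1 = \<top>"
    and mult_Sup: "a * \<Squnion>X = (\<Squnion>x\<in>X. a * x)"
begin

definition residual :: "'a \<Rightarrow> 'a \<Rightarrow> 'a" where
  "residual a b = \<Squnion>{x. x * b \<le> a}"

definition principal_element :: "'a \<Rightarrow> bool" where
  "principal_element e \<longleftrightarrow>
     (\<forall>a b. a \<sqinter> (b * e) = (residual a e \<sqinter> b) * e) \<and>
     (\<forall>a b. residual ((a * e) \<squnion> b) e = residual b e \<squnion> a)"

end

text \<open>The standing assumption on multiplicative lattices. The empty product \<open>1\<close> is compact, so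
  closure under binary products is closure under all finite products.\<close>

class c_lattice = multiplicative_lattice +
  assumes join_of_compact: "\<exists>X. (\<forall>x\<in>X. compact_element x) \<and> a = \<Squnion>X"
    and compact_one: "compact_element 1"
    and compact_mult: "compact_element a \<Longrightarrow> compact_element b \<Longrightarrow> compact_element (a * b)"

class pg_lattice = c_lattice +
  assumes join_of_principal: "\<exists>X. (\<forall>x\<in>X. principal_element x) \<and> a = \<Squnion>X"

locale lattice_module =
  fixes act :: "'l::c_lattice \<Rightarrow> 'm::complete_lattice \<Rightarrow> 'm"  (infixr \<open>\<odot>\<close> 75)
  assumes Sup_act: "\<Squnion>X \<odot> A = (\<Squnion>x\<in>X. x \<odot> A)"
    and act_Sup: "a \<odot> \<Squnion>Y = (\<Squnion>A\<in>Y. a \<odot> A)"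
    and mult_act: "(a * b) \<odot> A = a \<odot> (b \<odot> A)"
    and one_act: "1 \<odot> A = A"
    and bot_act: "\<bottom> \<odot> A = \<bottom>"
begin

definition module_residual :: "'m \<Rightarrow> 'm \<Rightarrow> 'l" where
  "module_residual A B = \<Squnion>{x. x \<odot> B \<le> A}"

definition faithful :: bool where
  "faithful \<longleftrightarrow> module_residual \<bottom> \<top> = \<bottom>"

definition multiplication_module :: bool where
  "multiplication_module \<longleftrightarrow> (\<forall>N. \<exists>a. N = a \<odot> \<top>)"

definition module_principal :: "'m \<Rightarrow> bool" where
  "module_principal N \<longleftrightarrow>
     (\<forall>b B. (b \<sqinter> module_residual B N) \<odot> N = (b \<odot> N) \<sqinter> B) \<and>
     (\<forall>b B. b \<squnion> module_residual B N = module_residual ((b \<odot> N) \<squnion> B) N)"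

definition pg_module :: bool where
  "pg_module \<longleftrightarrow> (\<forall>A. \<exists>X. (\<forall>N\<in>X. module_principal N) \<and> A = \<Squnion>X)"

definition prime_element :: "'m \<Rightarrow> bool" where
  "prime_element N \<longleftrightarrow>
     N < \<top> \<and> (\<forall>a X. a \<odot> X \<le> N \<longrightarrow> X \<le> N \<or> a \<odot> \<top> \<le> N)"

definition rad :: "'m \<Rightarrow> 'm" where
  "rad N = \<Sqinter>{P. prime_element P \<and> N \<le> P}"

definition pseudo_classical_primary :: "'m \<Rightarrow> bool" where
  "pseudo_classical_primary N \<longleftrightarrow>
     N < \<top> \<and> (\<forall>a b K. (a * b) \<odot> K \<le> N \<longrightarrow> a \<odot> K \<le> N \<or> b \<odot> K \<le> rad N)"

end

end

theory Submission
  imports Defs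
begin

text \<open>For a prime \<open>p\<close> of \<open>L\<close>, \<open>(pI\<^sub>M : I\<^sub>M) = p\<close>: write the compact element \<open>I\<^sub>M\<close> as a finite join
  of principal elements \<open>E\<^sub>i\<close>; the product of the annihilators \<open>(O\<^sub>M : E\<^sub>i)\<close> annihilates \<open>I\<^sub>M\<close>, hence
  is \<open>0\<close> by faithfulness, so some \<open>(O\<^sub>M : E\<^sub>i)\<close> lies below \<open>p\<close>, and
  \<open>(pE\<^sub>i : E\<^sub>i) = p \<or> (O\<^sub>M : E\<^sub>i) = p\<close>. Consequently \<open>pI\<^sub>M\<close> is prime, and Krull's argument in \<open>L\<close> shows
  that a compact \<open>b\<close> with \<open>bI\<^sub>M \<le> rad(N)\<close> satisfies \<open>b\<^sup>nI\<^sub>M \<le> N\<close> for some \<open>n\<close>. If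
  \<open>axI\<^sub>M \<le> rad(N)\<close> with \<open>a\<close>, \<open>x\<close> compact, then \<open>a\<^sup>nx\<^sup>nI\<^sub>M \<le> N\<close>, and the
  pseudo-classical primary condition at \<open>K = I\<^sub>M\<close> applies.\<close>

section \<open>Compact elements and chains\<close>

lemma Sup_mem_of_finite_chain:
  fixes F :: "'a::complete_lattice set"
  assumes "finite F" "F \<noteq> {}" "\<And>x y. x \<in> F \<Longrightarrow> y \<in> F \<Longrightarrow> x \<le> y \<or> y \<le> x"
  shows "\<Squnion>F \<in> F"
  using assms
proof (induction rule: finite_ne_induct)
  case (singleton x)
  then show ?case by simp
next
  case (insert x F)
  then have "\<Squnion>F \<in> F" by blast
  with insert.prems have "x \<le> \<Squnion>F \<or> \<Squnion>F \<le> x" by blast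
  with \<open>\<Squnion>F \<in> F\<close> show ?case by (auto simp: sup_absorb1 sup_absorb2)
qed

text \<open>A finite nonempty subset of a chain contains its own join, so the finite subfamily
  supplied by compactness collapses to a single member.\<close>

lemma compact_le_Sup_chain:
  fixes c :: "'a::complete_lattice"
  assumes "compact_element c" "c \<le> \<Squnion>C" "C \<noteq> {}"
    and "\<And>x y. x \<in> C \<Longrightarrow> y \<in> C \<Longrightarrow> x \<le> y \<or> y \<le> x"
  shows "\<exists>x\<in>C. c \<le> x"
proof -
  obtain F where F: "finite F" "F \<subseteq> C" "c \<le> \<Squnion>F"
    using assms(1,2) unfolding compact_element_def by blast
  show ?thesis
  proof (cases "F = {}")
    case True
    with F(3) have "c = \<bottom>" by (simp add: bot_unique)
    with \<open>C \<noteq> {}\<close> show ?thesis by auto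
  next
    case False
    then have "\<Squnion>F \<in> F" using F(1,2) assms(4) by (intro Sup_mem_of_finite_chain) blast+
    with F show ?thesis by blast
  qed
qed

section \<open>Prime elements of the multiplicative lattice\<close>

context multiplicative_lattice
begin

lemma mult_sup: "a * (x \<squnion> y) = a * x \<squnion> a * y"
  using mult_Sup[of a "{x, y}"] by simp

lemma mult_mono_right: "x \<le> y \<Longrightarrow> a * x \<le> a * y"
  using mult_sup[of a x y] by (simp add: le_iff_sup)

lemma mult_le_left: "a * b \<le> a"
  using mult_mono_right[of b 1 a] by (metis mult_1_right one_eq_top top_greatest)

lemma mult_le_right: "a * b \<le> b"
  using mult_le_left[of b a] by (simp add: mult.commute)

definition prime_in_lattice :: "'a \<Rightarrow> bool" where
  "prime_in_lattice p \<longleftrightarrow> p \<noteq> \<top> \<and> (\<forall>a b. a * b \<le> p \<longrightarrow> a \<le> p \<or> b \<le> p)"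

end

lemma compact_power:
  fixes b :: "'a::c_lattice"
  shows "compact_element b \<Longrightarrow> compact_element (b ^ n)"
  by (induction n) (auto intro: compact_one compact_mult)

text \<open>Zorn's lemma gives an element \<open>p\<close> maximal among those above
  \<open>q\<close> that dominate no power of \<open>b\<close>; maximality forces \<open>p\<close> to
  be prime.\<close>

lemma prime_in_lattice_separation:
  fixes b q :: "'a::c_lattice"
  assumes "compact_element b" and "\<And>n. \<not> b ^ n \<le> q"
  obtains p where "prime_in_lattice p" "q \<le> p" "\<not> b \<le> p"
proof -
  define S where "S = {x. q \<le> x \<and> (\<forall>n. \<not> b ^ n \<le> x)}"
  have "\<exists>p\<in>S. \<forall>x\<in>S. p \<le> x \<longrightarrow> x = p"
  proof (rule predicate_Zorn)
    show "partial_order_on S (relation_of (\<le>) S)"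
      by (rule partial_order_on_relation_ofI) auto
  next
    fix C assume "C \<in> Chains (relation_of (\<le>) S)"
    then have chain: "x \<le> y \<or> y \<le> x" and CS: "x \<in> S" if "x \<in> C" "y \<in> C" for x y
      using that by (auto simp: Chains_def relation_of_def)
    show "\<exists>u\<in>S. \<forall>x\<in>C. x \<le> u"
    proof (cases "C = {}")
      case True
      then show ?thesis using assms(2) by (auto simp: S_def)
    next
      case False
      then obtain c where c: "c \<in> C" by blast
      then have "q \<le> \<Squnion>C" using CS[OF c c] by (auto simp: S_def intro: Sup_upper2)
      \<comment> \<open>Powers of \<open>b\<close> are compact, so one lying below the join of the
        chain would already lie below a member of \<open>C\<close>.\<close>
      moreover have "\<not> b ^ n \<le> \<Squnion>C" for n
        using compact_le_Sup_chain[OF compact_power[OF assms(1)] _ False chain] CS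
        by (auto simp: S_def)
      ultimately show ?thesis by (auto simp: S_def intro!: bexI[of _ "\<Squnion>C"] Sup_upper)
    qed
  qed
  then obtain p where pS: "p \<in> S" and max: "\<And>x. x \<in> S \<Longrightarrow> p \<le> x \<Longrightarrow> x = p" by blast
  have power_le: "\<exists>n. b ^ n \<le> p \<squnion> a" if "\<not> a \<le> p" for a
  proof (rule ccontr)
    assume "\<nexists>n. b ^ n \<le> p \<squnion> a"
    then have "p \<squnion> a \<in> S" using pS by (auto simp: S_def intro: le_supI1)
    then have "p \<squnion> a = p" by (intro max) auto
    with that show False by (simp add: le_iff_sup sup.commute)
  qed
  have "prime_in_lattice p"
    unfolding prime_in_lattice_def
  proof (intro conjI allI impI)
    show "p \<noteq> \<top>" using pS by (auto simp: S_def)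
  next
    fix a c assume ac: "a * c \<le> p"
    show "a \<le> p \<or> c \<le> p"
    proof (rule ccontr)
      assume "\<not> (a \<le> p \<or> c \<le> p)"
      then obtain n m where nm: "b ^ n \<le> p \<squnion> a" "b ^ m \<le> p \<squnion> c" using power_le by blast
      \<comment> \<open>Expanding \<open>(p \<squnion> c) * (p \<squnion> a)\<close> leaves only
        terms with a factor \<open>p\<close> and the term \<open>a * c\<close>, all below
        \<open>p\<close>; yet a power of \<open>b\<close> lies below this product.\<close>
      have "b ^ (n + m) = b ^ n * b ^ m" by (rule power_add)
      also have "\<dots> \<le> b ^ n * (p \<squnion> c)" using nm by (intro mult_mono_right)
      also have "\<dots> = (p \<squnion> c) * b ^ n" by (rule mult.commute)
      also have "\<dots> \<le> (p \<squnion> c) * (p \<squnion> a)" using nm by (intro mult_mono_right)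
      also have "\<dots> = (p \<squnion> c) * p \<squnion> (a * p \<squnion> a * c)"
        by (simp add: mult_sup mult.commute[of _ a])
      also have "\<dots> \<le> p" using ac by (simp add: mult_le_right)
      finally show False using pS by (simp add: S_def)
    qed
  qed
  moreover have "\<not> b ^ 1 \<le> p" using pS unfolding S_def by blast
  ultimately show thesis using that pS by (simp add: S_def)
qed

lemma prime_in_lattice_prod:
  fixes p :: "'a::c_lattice"
  assumes "prime_in_lattice p" "finite F" "(\<Prod>i\<in>F. f i) \<le> p"
  shows "\<exists>i\<in>F. f i \<le> p"
  using assms(2,3)
proof (induction F rule: finite_induct)
  case empty
  then show ?case using assms(1) by (simp add: prime_in_lattice_def one_eq_top top_unique)
next
  case (insert i F)
  then show ?case using assms(1) by (auto simp: prime_in_lattice_def)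
qed

section \<open>Residuals, primes and radicals in the module\<close>

context lattice_module
begin

lemma act_sup: "a \<odot> (X \<squnion> Y) = a \<odot> X \<squnion> a \<odot> Y"
  using act_Sup[of a "{X, Y}"] by simp

lemma sup_act: "(a \<squnion> b) \<odot> X = a \<odot> X \<squnion> b \<odot> X"
  using Sup_act[of "{a, b}"] by simp

lemma act_mono_right: "X \<le> Y \<Longrightarrow> a \<odot> X \<le> a \<odot> Y"
  using act_sup[of a X Y] by (simp add: le_iff_sup)

lemma act_mono_left: "a \<le> b \<Longrightarrow> a \<odot> X \<le> b \<odot> X"
  using sup_act[of a b X] by (simp add: le_iff_sup)

lemma act_left_commute: "a \<odot> b \<odot> X = b \<odot> a \<odot> X"
  by (metis mult.commute mult_act)

lemma module_residual_act_le: "module_residual A B \<odot> B \<le> A"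
  unfolding module_residual_def Sup_act by (auto intro: SUP_least)

lemma le_module_residual_iff: "x \<le> module_residual A B \<longleftrightarrow> x \<odot> B \<le> A"
proof
  assume "x \<le> module_residual A B"
  then show "x \<odot> B \<le> A" by (meson act_mono_left module_residual_act_le order_trans)
qed (auto simp: module_residual_def intro: Sup_upper)

text \<open>The product lies below each of its factors, so it kills every \<open>E\<close> in
  \<open>F\<close> and therefore their join \<open>\<top>\<close>.\<close>

lemma annihilator_prod_eq_bot:
  assumes "faithful" "finite F" "\<top> \<le> \<Squnion>F"
  shows "(\<Prod>E\<in>F. module_residual \<bottom> E) = \<bottom>"
proof -
  have "(\<Prod>E\<in>F. module_residual \<bottom> E) \<odot> E \<le> \<bottom>" if "E \<in> F" for E
  proof -
    have "(\<Prod>E\<in>F. module_residual \<bottom> E) \<le> module_residual \<bottom> E"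
      using prod.remove[OF assms(2) that, of "module_residual \<bottom>"] by (simp add: mult_le_left)
    then show ?thesis by (simp add: le_module_residual_iff)
  qed
  then have "(\<Prod>E\<in>F. module_residual \<bottom> E) \<odot> \<Squnion>F \<le> \<bottom>" by (auto simp: act_Sup intro: SUP_least)
  then have "(\<Prod>E\<in>F. module_residual \<bottom> E) \<le> module_residual \<bottom> \<top>"
    using assms(3) by (simp add: le_module_residual_iff top_unique)
  then show ?thesis using assms(1) by (simp add: faithful_def bot_unique)
qed

lemma prime_cancel:
  assumes "faithful" "multiplication_module" "pg_module" "compact_element (\<top> :: 'm)"
    and p: "prime_in_lattice p" and le: "b \<odot> \<top> \<le> p \<odot> \<top>"
  shows "b \<le> p"
proof -
  obtain X where X: "\<forall>E\<in>X. module_principal E" "\<top> = \<Squnion>X"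
    using assms(3) unfolding pg_module_def by blast
  then obtain F where F: "finite F" "F \<subseteq> X" "\<top> \<le> \<Squnion>F"
    using assms(4) unfolding compact_element_def by (metis order_refl)
  have "(\<Prod>E\<in>F. module_residual \<bottom> E) \<le> p"
    using annihilator_prod_eq_bot[OF assms(1) F(1,3)] by simp
  then obtain E where E: "E \<in> F" "module_residual \<bottom> E \<le> p"
    using prime_in_lattice_prod[OF p F(1)] by blast
  \<comment> \<open>Writing \<open>E\<close> as a multiple of \<open>\<top>\<close> transfers the
    hypothesis from \<open>\<top>\<close> to \<open>E\<close>: multiply both sides by
    \<open>e\<close> and commute.\<close>
  obtain e where "E = e \<odot> \<top>" using assms(2) unfolding multiplication_module_def by blast
  then have "b \<odot> E \<le> p \<odot> E" using le by (simp add: act_left_commute[of _ e] act_mono_right)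
  \<comment> \<open>The join with \<open>\<bottom>\<close> gives the residual the form to which the
    second identity for principal elements applies, with \<open>B = \<bottom>\<close>.\<close>
  then have "b \<le> module_residual (p \<odot> E \<squnion> \<bottom>) E" by (simp add: le_module_residual_iff)
  also have "\<dots> = p \<squnion> module_residual \<bottom> E"
    using X(1) E(1) F(2) unfolding module_principal_def by (metis subsetD)
  finally show ?thesis using E(2) by (simp add: sup_absorb1)
qed

lemma prime_element_act_top:
  assumes "faithful" "multiplication_module" "pg_module" "compact_element (\<top> :: 'm)"
    and p: "prime_in_lattice p"
  shows "prime_element (p \<odot> \<top>)"
  unfolding prime_element_def
proof (intro conjI allI impI)
  have "p \<odot> \<top> \<noteq> \<top>"
  proof
    assume "p \<odot> \<top> = \<top>"
    then have "1 \<le> p" by (intro prime_cancel[OF assms]) simp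
    then show False using p by (simp add: prime_in_lattice_def one_eq_top top_unique)
  qed
  then show "p \<odot> \<top> < \<top>" by (simp add: less_top)
next
  fix a X assume aX: "a \<odot> X \<le> p \<odot> \<top>"
  obtain x where x: "X = x \<odot> \<top>" using assms(2) unfolding multiplication_module_def by blast
  \<comment> \<open>Cancelling \<open>\<top>\<close> turns primeness in the module into primeness of
    \<open>p\<close> in the lattice.\<close>
  then have "a * x \<le> p" using aX by (intro prime_cancel[OF assms]) (simp add: mult_act)
  then have "a \<le> p \<or> x \<le> p" using p by (simp add: prime_in_lattice_def)
  then show "X \<le> p \<odot> \<top> \<or> a \<odot> \<top> \<le> p \<odot> \<top>" using x act_mono_left by blast
qed

lemma le_rad: "N \<le> rad N"
  unfolding rad_def by (auto intro: Inf_greatest)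

text \<open>Otherwise separation yields a prime \<open>p\<close> above
  \<open>module_residual N \<top>\<close> but not above \<open>b\<close>. Then
  \<open>p \<odot> \<top>\<close> is a prime element above \<open>N\<close>, hence above
  \<open>rad N\<close> and \<open>b \<odot> \<top>\<close>, and cancellation gives
  \<open>b \<le> p\<close>.\<close>

lemma compact_act_top_le_rad:
  assumes "faithful" "multiplication_module" "pg_module" "compact_element (\<top> :: 'm)"
    and "compact_element b" "b \<odot> \<top> \<le> rad N"
  shows "\<exists>n. b ^ n \<odot> \<top> \<le> N"
proof (rule ccontr)
  assume "\<nexists>n. b ^ n \<odot> \<top> \<le> N"
  then have "\<not> b ^ n \<le> module_residual N \<top>" for n by (simp add: le_module_residual_iff)
  then obtain p where p: "prime_in_lattice p" "module_residual N \<top> \<le> p" "\<not> b \<le> p"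
    using prime_in_lattice_separation[OF assms(5)] by blast
  obtain c where c: "N = c \<odot> \<top>" using assms(2) unfolding multiplication_module_def by blast
  then have "c \<le> p" using p(2) le_module_residual_iff[of c N \<top>] by auto
  then have "N \<le> p \<odot> \<top>" using c act_mono_left by blast
  then have "rad N \<le> p \<odot> \<top>"
    unfolding rad_def using prime_element_act_top[OF assms(1-4) p(1)] by (auto intro: Inf_lower)
  then show False using prime_cancel[OF assms(1-4) p(1), of b] assms(6) p(3) order_trans by blast
qed

text \<open>Primeness strips off one factor \<open>b\<close> at a time; exponent \<open>0\<close>
  cannot occur because \<open>P\<close> is proper.\<close>

lemma prime_element_power_act_top:
  assumes "prime_element P" "b ^ n \<odot> \<top> \<le> P"
  shows "b \<odot> \<top> \<le> P"
  using assms(2)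
proof (induction n)
  case 0
  then show ?case using assms(1) by (simp add: prime_element_def one_act top_unique)
next
  case (Suc n)
  then show ?case using assms(1) by (auto simp: prime_element_def mult_act)
qed

lemma rad_power_act_top:
  assumes "b ^ n \<odot> \<top> \<le> rad N"
  shows "b \<odot> \<top> \<le> rad N"
  using assms unfolding rad_def le_Inf_iff by (blast intro: prime_element_power_act_top)

text \<open>This permits passing from arbitrary lattice elements to compact ones, for which the
  result on powers is available.\<close>

lemma compact_below_act_top:
  assumes "\<not> a \<odot> \<top> \<le> R"
  obtains c where "compact_element c" "c \<le> a" "\<not> c \<odot> \<top> \<le> R"
proof -
  obtain X where X: "\<forall>x\<in>X. compact_element x" "a = \<Squnion>X" using join_of_compact[of a] by blast
  with assms obtain c where "c \<in> X" "\<not> c \<odot> \<top> \<le> R" by (auto simp: Sup_act SUP_le_iff)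
  with X that show thesis by (auto intro: Sup_upper)
qed

theorem prime_element_rad:
  assumes "faithful" "multiplication_module" "pg_module" "compact_element (\<top> :: 'm)"
    and N: "pseudo_classical_primary N"
  shows "prime_element (rad N)"
  unfolding prime_element_def
proof (intro conjI allI impI)
  have "rad N \<noteq> \<top>"
  proof
    assume "rad N = \<top>"
    \<comment> \<open>All powers of the compact element \<open>1\<close> equal \<open>1\<close>, so
      \<open>\<top> \<le> N\<close> would follow, against properness of \<open>N\<close>.\<close>
    then have "\<exists>n. 1 ^ n \<odot> \<top> \<le> N" by (intro compact_act_top_le_rad[OF assms(1-4) compact_one]) simp
    then show False using N by (simp add: pseudo_classical_primary_def one_act top_unique)
  qed
  then show "rad N < \<top>" by (simp add: less_top)
next
  fix a X assume aX: "a \<odot> X \<le> rad N"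
  obtain x where x: "X = x \<odot> \<top>" using assms(2) unfolding multiplication_module_def by blast
  show "X \<le> rad N \<or> a \<odot> \<top> \<le> rad N"
  proof (rule ccontr)
    assume "\<not> (X \<le> rad N \<or> a \<odot> \<top> \<le> rad N)"
    then have "\<not> a \<odot> \<top> \<le> rad N" "\<not> x \<odot> \<top> \<le> rad N" using x by auto
    then obtain c y
      where c: "compact_element c" "c \<le> a" "\<not> c \<odot> \<top> \<le> rad N"
        and y: "compact_element y" "y \<le> x" "\<not> y \<odot> \<top> \<le> rad N"
      by (meson compact_below_act_top)
    have "(c * y) \<odot> \<top> \<le> a \<odot> x \<odot> \<top>"
      unfolding mult_act using c(2) y(2) by (meson act_mono_left act_mono_right order_trans)
    then have "(c * y) \<odot> \<top> \<le> rad N" using aX x by simp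
    then obtain n where "(c * y) ^ n \<odot> \<top> \<le> N"
      using compact_act_top_le_rad[OF assms(1-4) compact_mult[OF c(1) y(1)]] by blast
    \<comment> \<open>The primary condition is applied to \<open>c ^ n\<close>, \<open>y ^ n\<close>
      and \<open>K = \<top>\<close>. Its asymmetry is harmless: since \<open>N \<le> rad N\<close>,
      either alternative puts a power below \<open>rad N\<close>, and the exponent can be removed
      there.\<close>
    then have "c ^ n \<odot> \<top> \<le> N \<or> y ^ n \<odot> \<top> \<le> rad N"
      using N by (simp add: pseudo_classical_primary_def power_mult_distrib)
    then show False using c(3) y(3) rad_power_act_top le_rad order_trans by blast
  qed
qed

end

theorem theorem4p5:
  fixes act :: "'l::pg_lattice \<Rightarrow> 'm::complete_lattice \<Rightarrow> 'm"
    and N :: 'm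
  assumes "lattice_module act"
    and "lattice_module.faithful act"
    and "lattice_module.multiplication_module act"
    and "lattice_module.pg_module act"
    and "compact_element (\<top> :: 'm)"
    and "N < \<top>"
    and "lattice_module.pseudo_classical_primary act N"
  shows "lattice_module.prime_element act (lattice_module.rad act N)"
  using lattice_module.prime_element_rad[OF assms(1-5,7)] .

end
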